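(* Let $N\ge 2$. In the ring $A^*(\overline{M}_{0,2}(\mathbb{P}^{N-1},2))$ the following relations hold: $$h_0^N=0,\qquad h_1^N(h_0-2h_1+h_2)=0,\qquad h_2^N=0 .$$
   Context: Put $n:=N-1$. $\overline{M}_{0,2}(\mathbb{P}^{n},2)$ is the moduli space of degree $2$ stable maps from genus $0$ curves with two marked points to $\mathbb{P}^{n}$. Chow ring in degree $2$ (result of A. and M. Mustaţă): let $B^*=B^*(\overline{M}_{0,2}(\mathbb{P}^n,2))$ be the graded $\mathbb{Q}$-algebra with degree-one generators $H,\psi,T_1,T_2,U_1,U_2,S_0$ and ideal of relations generated by the following elements, where $S_2:=U_1+U_2$: (1) $H^{n+1}$; (2) $S_0U_1,\ S_0U_2,\ U_1U_2$; (3) $T_1T_2(\psi+S_0),\ T_1U_2\psi,\ T_2U_1\psi,\ T_1(\psi+U_1),\ T_2(\psi+U_2),\ S_0\psi$; (4) $(H+2\psi+U_1+U_2)^{n+1}$; (5a) $\sum_{i=0}^n(H+\psi+S_0)^{n-i}\bigl((H+2\psi+2S_0+U_1+T_1)^i+(H+2\psi+2S_0+U_2+T_2)^i-(H+2\psi+2S_0+U_1)^i-(H+2\psi+2S_0+U_2)^i\bigr)+\sum_{i=0}^n(H+\psi)^{n-i}\bigl((H+2\psi+S_2)^i-(H+2\psi)^i\bigr)+2\sum_{i=0}^nH^{n-i}(H+2\psi+2S_0)^i$; (5b) $T_1\sum_{i=0}^nH^{n-i}\bigl((H+U_2+T_2)^i+(H+\psi+S_0)^i-H^i\bigr)$ and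 $T_2\sum_{i=0}^nH^{n-i}\bigl((H+U_1+T_1)^i+(H+\psi+S_0)^i-H^i\bigr)$; (5c) $U_1\sum_{i=0}^nH^{n-i}\bigl((H+T_2)^i-H^i+(H+\psi)^i\bigr)$ and $U_2\sum_{i=0}^nH^{n-i}\bigl((H+T_1)^i-H^i+(H+\psi)^i\bigr)$. The Chow ring $A^*(\overline{M}_{0,2}(\mathbb{P}^n,2))$ (rational coefficients) is the subring of $B^*$ invariant under the involution $T_1\leftrightarrow T_2$, $U_1\leftrightarrow U_2$ (fixing $H,\psi,S_0$). Here $H=\mathrm{ev}_1^*h$ is the pullback of the hyperplane class by evaluation at the first marked point, $\psi=\psi_1$ is the $\psi$-class at the first marked point, and $T_i,U_i,S_0$ are classes attached to boundary strata. Set $h_0:=H$, $h_1:=H+\psi$, $h_2:=H+2\psi+S_2$. *)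

theory Defs
  imports "HOL-Library.Poly_Mapping" "HOL-Algebra.QuotRing" "HOL-Algebra.Subrings"
    "HOL-Algebra.Algebraic_Closure_Type"
begin

text \<open>
  The rational Chow ring of the moduli space of degree 2 stable maps of genus 0 with two marked
  points to n-dimensional projective space, in the presentation of A. and M. Mustata: a quotient of
  the polynomial ring over the rationals in seven variables, and the subring of invariants of an
  involution.  All seven generators have degree one and every relation is homogeneous.
\<close>

datatype gen = GH | GPsi | GT1 | GT2 | GU1 | GU2 | GS0

text \<open>Monomials are exponent functions; a polynomial maps monomials to rational coefficients.\<close>

type_synonym gpoly = "(gen \<Rightarrow>\<^sub>0 nat) \<Rightarrow>\<^sub>0 rat"

definition gvar :: "gen \<Rightarrow> gpoly" where
  "gvar g = Poly_Mapping.single (Poly_Mapping.single g 1) 1"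

abbreviation "pH \<equiv> gvar GH"
abbreviation "p\<psi> \<equiv> gvar GPsi"
abbreviation "pT1 \<equiv> gvar GT1"
abbreviation "pT2 \<equiv> gvar GT2"
abbreviation "pU1 \<equiv> gvar GU1"
abbreviation "pU2 \<equiv> gvar GU2"
abbreviation "pS0 \<equiv> gvar GS0"
abbreviation "pS2 \<equiv> pU1 + pU2"

abbreviation gpoly_ring :: "gpoly ring" where
  "gpoly_ring \<equiv> ring_of_type_algebra"

definition rel5a :: "nat \<Rightarrow> gpoly" where
  "rel5a n =
     (\<Sum>i=0..n. (pH + p\<psi> + pS0) ^ (n - i) *
        ((pH + 2 * p\<psi> + 2 * pS0 + pU1 + pT1) ^ i
         + (pH + 2 * p\<psi> + 2 * pS0 + pU2 + pT2) ^ i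
         - (pH + 2 * p\<psi> + 2 * pS0 + pU1) ^ i
         - (pH + 2 * p\<psi> + 2 * pS0 + pU2) ^ i))
     + (\<Sum>i=0..n. (pH + p\<psi>) ^ (n - i) * ((pH + 2 * p\<psi> + pS2) ^ i - (pH + 2 * p\<psi>) ^ i))
     + 2 * (\<Sum>i=0..n. pH ^ (n - i) * (pH + 2 * p\<psi> + 2 * pS0) ^ i)"

definition relations :: "nat \<Rightarrow> gpoly set" where
  "relations n =
     {pH ^ (n + 1)} \<union>
     {pS0 * pU1, pS0 * pU2, pU1 * pU2} \<union>
     {pT1 * pT2 * (p\<psi> + pS0), pT1 * pU2 * p\<psi>, pT2 * pU1 * p\<psi>,
      pT1 * (p\<psi> + pU1), pT2 * (p\<psi> + pU2), pS0 * p\<psi>} \<union>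
     {(pH + 2 * p\<psi> + pU1 + pU2) ^ (n + 1)} \<union>
     {rel5a n} \<union>
     {pT1 * (\<Sum>i=0..n. pH ^ (n - i) * ((pH + pU2 + pT2) ^ i + (pH + p\<psi> + pS0) ^ i - pH ^ i)),
      pT2 * (\<Sum>i=0..n. pH ^ (n - i) * ((pH + pU1 + pT1) ^ i + (pH + p\<psi> + pS0) ^ i - pH ^ i))} \<union>
     {pU1 * (\<Sum>i=0..n. pH ^ (n - i) * ((pH + pT2) ^ i - pH ^ i + (pH + p\<psi>) ^ i)),
      pU2 * (\<Sum>i=0..n. pH ^ (n - i) * ((pH + pT1) ^ i - pH ^ i + (pH + p\<psi>) ^ i))}"

definition rel_ideal :: "nat \<Rightarrow> gpoly set" where
  "rel_ideal n = Idl\<^bsub>gpoly_ring\<^esub> (relations n)"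

definition B_ring :: "nat \<Rightarrow> gpoly set ring" where
  "B_ring n = gpoly_ring Quot rel_ideal n"

definition cls :: "nat \<Rightarrow> gpoly \<Rightarrow> gpoly set" where
  "cls n p = rel_ideal n +>\<^bsub>gpoly_ring\<^esub> p"

fun swap_gen :: "gen \<Rightarrow> gen" where
  "swap_gen GT1 = GT2"
| "swap_gen GT2 = GT1"
| "swap_gen GU1 = GU2"
| "swap_gen GU2 = GU1"
| "swap_gen g = g"

text \<open>
  The substitution of variables along \<^const>\<open>swap_gen\<close>: the coefficient at \<open>m\<close> is the old
  coefficient at the swapped monomial (see \<open>swap_poly_gvar\<close> and the homomorphism laws below).
\<close>

definition swap_poly :: "gpoly \<Rightarrow> gpoly" where
  "swap_poly = Poly_Mapping.map_key (Poly_Mapping.map_key swap_gen)"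

text \<open>
  The induced involution of the quotient acts on a residue class, as a set of polynomials,
  by direct image; see \<open>swap_cls\<close>.
\<close>

definition chow_ring :: "nat \<Rightarrow> gpoly set ring" where
  "chow_ring n = (B_ring n)\<lparr>carrier := {C \<in> carrier (B_ring n). swap_poly ` C = C}\<rparr>"

definition h0 :: "nat \<Rightarrow> gpoly set" where "h0 n = cls n pH"
definition h1 :: "nat \<Rightarrow> gpoly set" where "h1 n = cls n (pH + p\<psi>)"
definition h2 :: "nat \<Rightarrow> gpoly set" where "h2 n = cls n (pH + 2 * p\<psi> + pS2)"


section \<open>The involution is well defined and its invariants form a subring\<close>

lemma swap_gen_swap_gen [simp]: "swap_gen (swap_gen g) = g"
  by (cases g) auto

lemma inj_swap_gen: "inj swap_gen"
  by (metis injI swap_gen_swap_gen)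

abbreviation swap_mon :: "(gen \<Rightarrow>\<^sub>0 nat) \<Rightarrow> (gen \<Rightarrow>\<^sub>0 nat)" where
  "swap_mon \<equiv> Poly_Mapping.map_key swap_gen"

lemma swap_mon_swap_mon [simp]: "swap_mon (swap_mon m) = m"
proof -
  have "swap_gen \<circ> swap_gen = (\<lambda>x. x)" by (rule ext) simp
  then show ?thesis using map_key_compose[OF inj_swap_gen inj_swap_gen, of m] 
    by (simp add: map_key_id)
qed

lemma inj_swap_mon: "inj swap_mon"
  by (metis injI swap_mon_swap_mon)

lemma swap_poly_swap_poly [simp]: "swap_poly (swap_poly p) = p"
proof -
  have "swap_mon \<circ> swap_mon = (\<lambda>x. x)" by (rule ext) simp
  then show ?thesis using map_key_compose[OF inj_swap_mon inj_swap_mon, of p]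
    by (simp add: map_key_id swap_poly_def)
qed

lemma swap_mon_single: "swap_mon (Poly_Mapping.single g k) = Poly_Mapping.single (swap_gen g) k"
  using map_key_single[OF inj_swap_gen, of "swap_gen g" k] by simp

lemma swap_poly_single: "swap_poly (Poly_Mapping.single m c) = Poly_Mapping.single (swap_mon m) c"
  using map_key_single[OF inj_swap_mon, of "swap_mon m" c] by (simp add: swap_poly_def)

lemma swap_poly_gvar: "swap_poly (gvar g) = gvar (swap_gen g)"
  by (simp add: gvar_def swap_poly_single swap_mon_single)

lemma swap_poly_add: "swap_poly (p + q) = swap_poly p + swap_poly q"
  by (simp add: swap_poly_def map_key_plus[OF inj_swap_mon])

lemma swap_poly_zero [simp]: "swap_poly 0 = 0"
  by (simp add: swap_poly_def map_key_zero[OF inj_swap_mon])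

lemma swap_poly_minus: "swap_poly (- p) = - swap_poly p"
  by (metis add.right_inverse add_eq_0_iff swap_poly_add swap_poly_zero)

lemma swap_poly_diff: "swap_poly (p - q) = swap_poly p - swap_poly q"
  by (metis diff_conv_add_uminus swap_poly_add swap_poly_minus)

lemma gpoly_induct:
  fixes p :: gpoly
  assumes "P 0" and "\<And>p m c. P p \<Longrightarrow> P (p + Poly_Mapping.single m c)"
  shows "P p"
proof (induction p rule: update_induct)
  case const
  then show ?case by (simp add: assms)
next
  case (update f a b)
  have "Poly_Mapping.update a b f = f + Poly_Mapping.single a b"
    using update(1) 
    by (intro poly_mapping_eqI) (auto simp: lookup_update lookup_add lookup_single in_keys_iff when_def)
  then show ?case using update assms(2) by simp
qed

lemma swap_poly_mult: "swap_poly (p * q) = swap_poly p * swap_poly q"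
proof (induction p rule: gpoly_induct)
  case 1
  then show ?case by simp
next
  case (2 p m c)
  have "swap_poly (Poly_Mapping.single m c * q) = swap_poly (Poly_Mapping.single m c) * swap_poly q"
  proof (induction q rule: gpoly_induct)
    case (2 q m' c')
    then show ?case
      by (simp add: distrib_left swap_poly_add mult_single swap_poly_single
          map_key_plus[OF inj_swap_gen])
  qed simp
  with 2 show ?case by (simp add: distrib_right swap_poly_add)
qed

lemma swap_poly_one [simp]: "swap_poly 1 = 1"
  using swap_poly_single[of 0 1] by (simp add: map_key_zero[OF inj_swap_gen])

lemma swap_poly_power: "swap_poly (p ^ k) = swap_poly p ^ k"
  by (induction k) (simp_all add: swap_poly_mult)

lemma swap_poly_numeral: "swap_poly (numeral k) = numeral k"
  by (induction k) (simp_all only: numeral.simps swap_poly_add swap_poly_one)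

lemma swap_poly_sum: "swap_poly (\<Sum>i\<in>A. f i) = (\<Sum>i\<in>A. swap_poly (f i))"
  by (induction A rule: infinite_finite_induct) (simp_all add: swap_poly_add)

lemmas swap_poly_hom = swap_poly_gvar swap_poly_add swap_poly_diff swap_poly_mult
  swap_poly_power swap_poly_numeral swap_poly_sum

lemma swap_poly_relations: "swap_poly ` relations n = relations n"
proof -
  have "swap_poly ` relations n \<subseteq> relations n" for n
    unfolding relations_def rel5a_def
    by (simp only: image_Un image_insert image_empty swap_poly_hom swap_gen.simps)
      (simp add: algebra_simps)
  from this[of n] image_mono[OF this[of n], of swap_poly] show ?thesis
    by (auto simp: image_image)
qed

lemma gpoly_ring_simps:
  "carrier gpoly_ring = UNIV" "x \<otimes>\<^bsub>gpoly_ring\<^esub> y = x * y" "x \<oplus>\<^bsub>gpoly_ring\<^esub> y = x + y"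
  "\<one>\<^bsub>gpoly_ring\<^esub> = 1" "\<zero>\<^bsub>gpoly_ring\<^esub> = 0"
  by (simp_all add: ring_of_type_algebra_def)

lemma cring_gpoly_ring: "cring gpoly_ring"
  by (rule cring_from_type_algebra)

lemma ideal_rel_ideal: "ideal (rel_ideal n) gpoly_ring"
  unfolding rel_ideal_def
  by (intro ring.genideal_ideal cring.axioms(1) cring_gpoly_ring) (simp add: gpoly_ring_simps)

lemma cring_B_ring: "cring (B_ring n)"
  unfolding B_ring_def by (intro ideal.quotient_is_cring ideal_rel_ideal cring_gpoly_ring)

lemma cls_eq: "cls n p = {q + p |q. q \<in> rel_ideal n}"
  by (auto simp: cls_def a_r_coset_def r_coset_def ring_of_type_algebra_def)

lemma cls_ring_hom: "cls n \<in> ring_hom gpoly_ring (B_ring n)"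
  using ideal.rcos_ring_hom[OF ideal_rel_ideal] unfolding cls_def B_ring_def .

lemma carrier_B_ring: "carrier (B_ring n) = range (cls n)"
  by (auto simp: B_ring_def FactRing_def A_RCOSETS_def' cls_def gpoly_ring_simps)

lemma swap_poly_ring_hom: "swap_poly \<in> ring_hom gpoly_ring gpoly_ring"
  by (auto simp: ring_hom_def gpoly_ring_simps swap_poly_mult swap_poly_add)

lemma swap_poly_rel_ideal: "swap_poly ` rel_ideal n = rel_ideal n"
proof -
  interpret cring gpoly_ring by (rule cring_gpoly_ring)
  interpret I: ideal "rel_ideal n" gpoly_ring by (rule ideal_rel_ideal)
  interpret S: ring_hom_ring gpoly_ring gpoly_ring swap_poly
    by (intro ring_hom_ringI2 swap_poly_ring_hom local.ring_axioms)
  have sub: "relations n \<subseteq> rel_ideal n"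
    unfolding rel_ideal_def by (rule genideal_self) (simp add: gpoly_ring_simps)
  have "ideal {p. swap_poly p \<in> rel_ideal n} gpoly_ring"
    using S.ideal_vimage[OF ideal_rel_ideal]
    by (simp add: gpoly_ring_simps)
  moreover have "relations n \<subseteq> {p. swap_poly p \<in> rel_ideal n}"
    using sub swap_poly_relations[of n] by blast
  ultimately have "rel_ideal n \<subseteq> {p. swap_poly p \<in> rel_ideal n}"
    using genideal_minimal by (subst rel_ideal_def) blast
  then show ?thesis
    by (auto simp: image_iff) (metis mem_Collect_eq subsetD swap_poly_swap_poly)
qed

lemma swap_cls: "swap_poly ` cls n p = cls n (swap_poly p)"
proof -
  have "swap_poly ` cls n p = {q + swap_poly p |q. q \<in> swap_poly ` rel_ideal n}"
    by (force simp: cls_eq swap_poly_add)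
  then show ?thesis by (simp add: swap_poly_rel_ideal cls_eq)
qed

lemma swap_B_ring_hom: "(`) swap_poly \<in> ring_hom (B_ring n) (B_ring n)"
proof -
  note h = ring_hom_closed[OF cls_ring_hom] ring_hom_mult[OF cls_ring_hom, symmetric]
    ring_hom_add[OF cls_ring_hom, symmetric] ring_hom_one[OF cls_ring_hom, symmetric]
  show ?thesis
    by (rule ring_hom_memI; (elim imageE | simp only: carrier_B_ring)?;
        (elim imageE)?; simp add: h swap_cls gpoly_ring_simps swap_poly_mult swap_poly_add)
qed

lemma subcring_invariants: "subcring {C \<in> carrier (B_ring n). swap_poly ` C = C} (B_ring n)"
proof -
  interpret cring "B_ring n" by (rule cring_B_ring)
  interpret S: ring_hom_ring "B_ring n" "B_ring n" "(`) swap_poly"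
    by (intro ring_hom_ringI2 swap_B_ring_hom local.ring_axioms)
  show ?thesis
    by (intro subcringI' subringI) (auto simp del: image_is_empty)
qed

lemma cring_chow_ring: "cring (chow_ring n)"
proof -
  note sub = subcring_invariants[of n]
  have "ring (chow_ring n)"
    unfolding chow_ring_def
    by (intro ring.subring_is_ring cring.axioms(1) cring_B_ring subcring.axioms(1)[OF sub])
  then show ?thesis
    by (intro cring.intro monoid.monoid_comm_monoidI ring.is_monoid)
      (auto simp: chow_ring_def subcring.sub_m_comm[OF sub])
qed

end

theory Submission
  imports Defs
begin

text \<open>
  Since \<open>h\<^sub>0 - 2h\<^sub>1 + h\<^sub>2 = U\<^sub>1 + U\<^sub>2\<close>, the middle relation says \<open>(U\<^sub>1 + U\<^sub>2)(H + \<psi>)\<^sup>N = 0\<close>.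
  Multiply the first relation of (5c) by \<open>\<psi>\<close>: as \<open>T\<^sub>2U\<^sub>1\<psi> = 0\<close>, the terms \<open>(H + T\<^sub>2)\<^sup>i - H\<^sup>i\<close> drop out,
  and the remaining geometric sum telescopes to \<open>U\<^sub>1((H + \<psi>)\<^sup>N - H\<^sup>N)\<close>, where \<open>H\<^sup>N = 0\<close>.
  The other two relations are (1) and (4).
\<close>

text \<open>Telescoping: \<open>p\<close> is the difference of the two bases \<open>h + p\<close>
  and \<open>h\<close>.\<close>

lemma mult_geometric_sum:
  fixes h p :: "'a :: comm_ring_1"
  shows "p * (\<Sum>i=0..n. h ^ (n - i) * (h + p) ^ i) = (h + p) ^ (n + 1) - h ^ (n + 1)"
proof -
  have "(\<Sum>i=0..n. h ^ (n - i) * (h + p) ^ i) = (\<Sum>i<Suc n. (h + p) ^ i * h ^ (n - i))"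
    by (rule sum.cong) (auto simp: mult.commute)
  then show ?thesis
    using power_diff_sumr2[of "h + p" "Suc n" h] by (simp add: mult.commute)
qed

lemma dvd_power_add_diff:
  fixes h t :: "'a :: comm_ring_1"
  shows "t dvd (h + t) ^ i - h ^ i"
  using power_diff_sumr2[of "h + t" i h] by simp

context
  fixes n :: nat
begin

interpretation P: cring gpoly_ring
  by (rule cring_gpoly_ring)

interpretation I: ideal "rel_ideal n" gpoly_ring
  by (rule ideal_rel_ideal)

interpretation A: cring "chow_ring n"
  by (rule cring_chow_ring)

lemma relations_subset_rel_ideal: "relations n \<subseteq> rel_ideal n"
  unfolding rel_ideal_def by (rule P.genideal_self) (simp add: gpoly_ring_simps)

lemma rel_ideal_add: "p \<in> rel_ideal n \<Longrightarrow> q \<in> rel_ideal n \<Longrightarrow> p + q \<in> rel_ideal n"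
  using I.a_closed[of p q] by (simp add: gpoly_ring_simps)

lemma rel_ideal_mult: "p \<in> rel_ideal n \<Longrightarrow> q * p \<in> rel_ideal n"
  using I.I_l_closed[of p q] by (simp add: gpoly_ring_simps)

text \<open>Serves both relations of (5c), with \<open>(u, t)\<close> equal to
  \<open>(pU1, pT2)\<close> and \<open>(pU2, pT1)\<close>.\<close>

lemma annihilator_h1_power:
  assumes "t * u * p\<psi> \<in> rel_ideal n"
    and "u * (\<Sum>i=0..n. pH ^ (n - i) * ((pH + t) ^ i - pH ^ i + (pH + p\<psi>) ^ i)) \<in> rel_ideal n"
      (is "u * ?S \<in> _")
  shows "u * (pH + p\<psi>) ^ (n + 1) \<in> rel_ideal n"
proof -
  \<comment> \<open>Each difference of powers has the factor \<open>t\<close>, so multiplying this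
    part by \<open>u * p\<psi>\<close> gives a multiple of \<open>t * u * p\<psi>\<close>.\<close>
  have "t dvd (\<Sum>i=0..n. pH ^ (n - i) * ((pH + t) ^ i - pH ^ i))"
    by (intro dvd_sum dvd_mult dvd_power_add_diff)
  then obtain q where q: "(\<Sum>i=0..n. pH ^ (n - i) * ((pH + t) ^ i - pH ^ i)) = t * q" ..
  have "?S = t * q + (\<Sum>i=0..n. pH ^ (n - i) * (pH + p\<psi>) ^ i)"
    unfolding q[symmetric] by (simp add: distrib_left sum.distrib)
  then have "p\<psi> * ?S = p\<psi> * t * q + ((pH + p\<psi>) ^ (n + 1) - pH ^ (n + 1))"
    by (simp only: distrib_left mult_geometric_sum mult.assoc)
  \<comment> \<open>Stated for arbitrary \<open>a\<close>, \<open>b\<close>, \<open>s\<close>, so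
    that simplification does not expand the powers and the sum. The right side is a combination of
    three elements of the ideal once \<open>b\<close> is \<open>pH ^ (n + 1)\<close>.\<close>
  moreover have "u * a = p\<psi> * (u * s) + (- q) * (t * u * p\<psi>) + u * b"
    if "p\<psi> * s = p\<psi> * t * q + (a - b)" for a b s
  proof -
    have "a = p\<psi> * s - p\<psi> * t * q + b" using that by simp
    show ?thesis unfolding \<open>a = _\<close> by (simp add: algebra_simps)
  qed
  ultimately have "u * (pH + p\<psi>) ^ (n + 1)
      = p\<psi> * (u * ?S) + (- q) * (t * u * p\<psi>) + u * pH ^ (n + 1)"
    by blast
  moreover have "pH ^ (n + 1) \<in> rel_ideal n"
    using relations_subset_rel_ideal unfolding relations_def by blast
  ultimately show ?thesis
    using assms by (simp only: rel_ideal_add rel_ideal_mult)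
qed

lemma h1_power_S2_rel_ideal: "(pH + p\<psi>) ^ (n + 1) * pS2 \<in> rel_ideal n"
proof -
  have "pU1 * (pH + p\<psi>) ^ (n + 1) \<in> rel_ideal n"
    using relations_subset_rel_ideal
    by (intro annihilator_h1_power[of pT2]) (unfold relations_def, blast+)
  moreover have "pU2 * (pH + p\<psi>) ^ (n + 1) \<in> rel_ideal n"
    using relations_subset_rel_ideal
    by (intro annihilator_h1_power[of pT1]) (unfold relations_def, blast+)
  ultimately show ?thesis
    using rel_ideal_add by (fastforce simp: algebra_simps)
qed

text \<open>The zero of the quotient is the ideal itself, which is the coset of each of its
  members.\<close>

lemma cls_eq_zero: "p \<in> rel_ideal n \<Longrightarrow> cls n p = \<zero>\<^bsub>chow_ring n\<^esub>"
  using I.a_rcos_const[of p] by (simp add: cls_def chow_ring_def B_ring_def FactRing_def)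

lemma cls_in_chow_ring: "swap_poly p = p \<Longrightarrow> cls n p \<in> carrier (chow_ring n)"
  by (simp add: chow_ring_def carrier_B_ring swap_cls)

lemma cls_mult: "cls n p \<otimes>\<^bsub>chow_ring n\<^esub> cls n q = cls n (p * q)"
  using ring_hom_mult[OF cls_ring_hom, of p q n] by (simp add: chow_ring_def gpoly_ring_simps)

lemma cls_add: "cls n p \<oplus>\<^bsub>chow_ring n\<^esub> cls n q = cls n (p + q)"
  using ring_hom_add[OF cls_ring_hom, of p q n] by (simp add: chow_ring_def gpoly_ring_simps)

lemma cls_one: "\<one>\<^bsub>chow_ring n\<^esub> = cls n 1"
  using ring_hom_one[OF cls_ring_hom, of n] by (simp add: chow_ring_def gpoly_ring_simps)

lemma cls_power: "cls n p [^]\<^bsub>chow_ring n\<^esub> (k::nat) = cls n (p ^ k)"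
  by (induction k) (simp_all add: cls_one cls_mult mult.commute)

text \<open>Additive inverses in \<open>chow_ring n\<close> are taken within its smaller carrier.
  Invariance puts the classes there, and \<open>p = (p - q) + q\<close> then determines the
  difference.\<close>

lemma cls_diff:
  assumes "swap_poly p = p" "swap_poly q = q"
  shows "cls n p \<ominus>\<^bsub>chow_ring n\<^esub> cls n q = cls n (p - q)"
proof -
  have "cls n (p - q) \<in> carrier (chow_ring n)" "cls n q \<in> carrier (chow_ring n)"
    using assms by (simp_all add: cls_in_chow_ring swap_poly_diff)
  moreover have "cls n p = cls n (p - q) \<oplus>\<^bsub>chow_ring n\<^esub> cls n q"
    by (simp add: cls_add)
  ultimately show ?thesis
    by (simp add: A.minus_eq A.a_assoc A.r_neg)
qed

lemma cls_double:
  assumes "swap_poly p = p"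
  shows "[(2::nat)] \<cdot>\<^bsub>chow_ring n\<^esub> cls n p = cls n (2 * p)"
  using cls_in_chow_ring[OF assms]
  by (simp add: numeral_2_eq_2 A.add.nat_pow_Suc cls_add flip: mult_2)

end

theorem lemma1p1:
  fixes N :: nat
  assumes "N \<ge> 2"
  shows "let n = N - 1; A = chow_ring n in
    h0 n \<in> carrier A \<and> h1 n \<in> carrier A \<and> h2 n \<in> carrier A \<and>
    h0 n [^]\<^bsub>A\<^esub> N = \<zero>\<^bsub>A\<^esub> \<and>
    h1 n [^]\<^bsub>A\<^esub> N \<otimes>\<^bsub>A\<^esub> (h0 n \<ominus>\<^bsub>A\<^esub> [(2::nat)] \<cdot>\<^bsub>A\<^esub> h1 n \<oplus>\<^bsub>A\<^esub> h2 n) = \<zero>\<^bsub>A\<^esub> \<and>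
    h2 n [^]\<^bsub>A\<^esub> N = \<zero>\<^bsub>A\<^esub>"
proof -
  define n where "n = N - 1"
  \<comment> \<open>The bound on \<open>N\<close> excludes truncated subtraction at
    \<open>0\<close>, so the exponent \<open>n + 1\<close> in the relations is
    \<open>N\<close>.\<close>
  have N: "N = n + 1" using assms by (simp add: n_def)
  have inv: "swap_poly pH = pH" "swap_poly (pH + p\<psi>) = pH + p\<psi>"
    "swap_poly (2 * (pH + p\<psi>)) = 2 * (pH + p\<psi>)"
    "swap_poly (pH + 2 * p\<psi> + pS2) = pH + 2 * p\<psi> + pS2"
    by (simp_all add: swap_poly_hom add.commute)
  have "pH ^ N \<in> rel_ideal n" "(pH + 2 * p\<psi> + pS2) ^ N \<in> rel_ideal n"
    using relations_subset_rel_ideal[of n] unfolding relations_def N by (auto simp: add.assoc)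
  \<comment> \<open>The second difference of the \<open>h\<close> classes cancels \<open>pH\<close>
    and \<open>p\<psi>\<close>, leaving only the boundary class.\<close>
  moreover have "pH - 2 * (pH + p\<psi>) + (pH + 2 * p\<psi> + pS2) = pS2"
    by (simp add: algebra_simps)
  then have "(pH + p\<psi>) ^ N * (pH - 2 * (pH + p\<psi>) + (pH + 2 * p\<psi> + pS2)) \<in> rel_ideal n"
    using h1_power_S2_rel_ideal[of n] by (simp only: N)
  ultimately show ?thesis
    unfolding Let_def n_def[symmetric] h0_def h1_def h2_def
    by (simp only: cls_in_chow_ring inv cls_power cls_mult cls_add cls_diff cls_double cls_eq_zero
        simp_thms)
qed

end
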